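(* Let $X$ be a well-formed C++ execution with transactions that satisfies the (transactional) C++ consistency axioms HbCom, RMWIsol, NoThinAir and SeqCst, and let $\mathit{stxn}_{\rm at}\subseteq \mathit{stxn}$ be the relation identifying its atomic transactions. If NoRace holds, and atomic transactions contain no atomic operations (i.e., $\mathrm{domain}(\mathit{stxn}_{\rm at})\cap \mathit{Ato}=\emptyset$), then the relation $\mathsf{stronglift}(\mathit{com},\mathit{stxn}_{\rm at})$ is acyclic.
   Context: **Notation.** For binary relations on a set of events $E$: $r^{-1}$, $r^?$, $r^+$, $r^*$ are inverse, reflexive closure, transitive closure, reflexive-transitive closure; $\neg$ is complement; $r_1;r_2$ is relational composition (left to right); $[s]=\{(x,x)\mid x\in s\}$; a relation $r$ is acyclic iff $r^+$ is irreflexive; $\mathit{id}$ is the identity. For an execution with program order $\mathit{po}$ and same-location relation $\mathit{sloc}$: $r_{\rm e}=r\setminus(\mathit{po}\cup\mathit{po}^{-1})^*$ (inter-thread part), $r_{\rm loc}=r\cap\mathit{sloc}$, $r_{\neq\rm loc}=r\setminus\mathit{sloc}$. **Executions.** An execution is a finite set $E$ of events, partitioned into reads $R$, writes $W$, fences $F$, with relations satisfying: $\mathit{po}$ is, for each thread, a strict total order on that thread's events (and relates only events of the same thread); $\mathit{sloc}$ is an equivalence relation on $R\cup W$ (same location); $\mathit{rmw}\subseteq\mathit{po}_{\rm loc}$ links the read of a read-modify-write operation to its write; $\mathit{rf}$ goes from writes to reads of the same location, each read having at most one incoming $\mathit{rf}$ edge (a read with none reads the initial value); $\mathit{co}$ relates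 writes to the same location and is, for each location, a strict total order on the writes to it; $\mathit{stxn}$ (events in the same successful transaction) is a partial equivalence relation (symmetric, transitive) each of whose classes is a contiguous subset of $\mathit{po}$ (of one thread). Derived: $\mathit{fr}=([R];\mathit{sloc};[W])\setminus(\mathit{rf}^{-1};(\mathit{co}^{-1})^* )$ and $\mathit{com}=\mathit{rf}\cup\mathit{co}\cup\mathit{fr}$. Also $$\mathsf{weaklift}(r,t)=t;(r\setminus t);t,\qquad \mathsf{stronglift}(r,t)=t^?;(r\setminus t);t^?.$$ **C++ executions** have in addition sets of events $\mathit{Ato}$ (events of atomic operations) and $\mathit{Acq},\mathit{Rel},\mathit{SC}\subseteq\mathit{Ato}$ (acquire, release, SC modes), with $R\cap\mathit{SC}\subseteq\mathit{Acq}$, $W\cap\mathit{SC}\subseteq\mathit{Rel}$, $F\cap\mathit{SC}\subseteq\mathit{Acq}\cap\mathit{Rel}$, and both ends of $\mathit{rmw}$ edges in $\mathit{Ato}$. The relation $\mathit{stxn}_{\rm at}$ is a partial equivalence relation identifying a subset of the transactions as atomic: its classes are some of the $\mathit{stxn}$ classes (so $\mathit{stxn}_{\rm at}\subseteq\mathit{stxn}$ and $\mathit{stxn}_{\rm at};\mathit{stxn}\subseteq\mathit{stxn}_{\rm at}$). **C++ relations.** - $\mathit{sw}=[\mathit{Rel}];([F];\mathit{po})^?;[W];\mathit{po}_{\rm loc}^*;[W\cap\mathit{Ato}];(\mathit{rf};\mathit{rmw})^*;\mathit{rf};[R\cap\mathit{Ato}];(\mathit{po};[F])^?;[\mathit{Acq}]$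 - $\mathit{ecom}=\mathit{com}\cup(\mathit{co};\mathit{rf})$, $\quad\mathit{tsw}=\mathsf{weaklift}(\mathit{ecom},\mathit{stxn})$, $\quad\mathit{hb}=(\mathit{sw}\cup\mathit{tsw}\cup\mathit{po})^+$ - $\mathit{scb}=\mathit{po}\cup(\mathit{po}_{\neq\rm loc};\mathit{hb};\mathit{po}_{\neq\rm loc})\cup\mathit{hb}_{\rm loc}\cup\mathit{co}\cup\mathit{fr}$ - $\mathit{psc}=\big(([\mathit{SC}]\cup[F\cap\mathit{SC}];\mathit{hb}^?);\mathit{scb};([\mathit{SC}]\cup\mathit{hb}^?;[F\cap\mathit{SC}])\big)\cup\big([F\cap\mathit{SC}];(\mathit{hb}\cup\mathit{hb};\mathit{com}^+;\mathit{hb});[F\cap\mathit{SC}]\big)$ - $\mathit{cnf}=((W\times W)\cup(R\times W)\cup(W\times R))\cap\mathit{sloc}\setminus\mathit{id}$ **Consistency axioms.** HbCom: $\mathit{hb};\mathit{com}^*$ is irreflexive. RMWIsol: $\mathit{rmw}\cap(\mathit{fr}_{\rm e};\mathit{co}_{\rm e})=\emptyset$. NoThinAir: $\mathit{po}\cup\mathit{rf}$ is acyclic. SeqCst: $\mathit{psc}$ is acyclic. **Race freedom.** NoRace: $\mathit{cnf}\setminus\mathit{Ato}^2\setminus(\mathit{hb}\cup\mathit{hb}^{-1})=\emptyset$. *)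

theory Defs
  imports Main "HOL-Library.Disjoint_Sets"
begin

text \<open>
  Relations are sets of pairs over the type of events. Library notation: \<open>r O s\<close> composes left to
  right, \<open>Id_on S\<close> is \<open>[S]\<close>, \<open>r\<^sup>=\<close> is the reflexive closure. The closures \<open>r\<^sup>=\<close> and \<open>r\<^sup>*\<close> are
  taken over the whole type; wherever they occur below they are composed with, or subtracted from,
  relations over the events of the execution, so elements of the type that are not events
  contribute no pairs.
\<close>

definition weaklift :: "'e rel \<Rightarrow> 'e rel \<Rightarrow> 'e rel" where
  "weaklift r t = t O (r - t) O t"

definition stronglift :: "'e rel \<Rightarrow> 'e rel \<Rightarrow> 'e rel" where
  "stronglift r t = t\<^sup>= O (r - t) O t\<^sup>="

record 'e exec =
  evts :: "'e set"
  Rd :: "'e set"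
  Wr :: "'e set"
  Fn :: "'e set"
  threads :: "'e set set" \<comment> \<open>each thread is given by its set of events\<close>
  po :: "'e rel"
  sloc :: "'e rel"
  rmw :: "'e rel"
  rf :: "'e rel"
  co :: "'e rel"
  stxn :: "'e rel"

record 'e cpp_exec = "'e exec" +
  Ato :: "'e set"
  Acq :: "'e set"
  Rel :: "'e set"
  SC :: "'e set"
  stxn_at :: "'e rel"

definition ext :: "('e, 'x) exec_scheme \<Rightarrow> 'e rel \<Rightarrow> 'e rel" where
  "ext X r = r - (po X \<union> (po X)\<inverse>)\<^sup>*"

definition same_loc :: "('e, 'x) exec_scheme \<Rightarrow> 'e rel \<Rightarrow> 'e rel" where
  "same_loc X r = r \<inter> sloc X"

definition diff_loc :: "('e, 'x) exec_scheme \<Rightarrow> 'e rel \<Rightarrow> 'e rel" where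
  "diff_loc X r = r - sloc X"

definition po_contiguous :: "('e, 'x) exec_scheme \<Rightarrow> 'e set \<Rightarrow> bool" where
  "po_contiguous X C \<longleftrightarrow>
     (\<exists>T\<in>threads X. C \<subseteq> T) \<and>
     (\<forall>a b c. a \<in> C \<and> c \<in> C \<and> (a, b) \<in> po X \<and> (b, c) \<in> po X \<longrightarrow> b \<in> C)"

text \<open>
  The classes of a partial equivalence relation \<open>t\<close> are \<open>Field t // t\<close>, and locations are the
  classes of \<open>sloc\<close>.
\<close>

definition wf_exec :: "('e, 'x) exec_scheme \<Rightarrow> bool" where
  "wf_exec X \<longleftrightarrow>
     finite (evts X) \<and>
     evts X = Rd X \<union> Wr X \<union> Fn X \<and>
     Rd X \<inter> Wr X = {} \<and> Rd X \<inter> Fn X = {} \<and> Wr X \<inter> Fn X = {} \<and>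
     partition_on (evts X) (threads X) \<and>
     po X \<subseteq> (\<Union>T\<in>threads X. T \<times> T) \<and>
     (\<forall>T\<in>threads X. strict_linear_order_on T (Restr (po X) T)) \<and>
     equiv (Rd X \<union> Wr X) (sloc X) \<and>
     rmw X \<subseteq> (Rd X \<times> Wr X) \<inter> same_loc X (po X) \<and>
     rf X \<subseteq> (Wr X \<times> Rd X) \<inter> sloc X \<and>
     single_valued ((rf X)\<inverse>) \<and>
     co X \<subseteq> (Wr X \<times> Wr X) \<inter> sloc X \<and>
     (\<forall>L \<in> (Rd X \<union> Wr X) // sloc X.
        strict_linear_order_on (L \<inter> Wr X) (Restr (co X) (L \<inter> Wr X))) \<and>
     stxn X \<subseteq> evts X \<times> evts X \<and> sym (stxn X) \<and> trans (stxn X) \<and>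
     (\<forall>C \<in> Field (stxn X) // stxn X. po_contiguous X C)"

definition fr :: "('e, 'x) exec_scheme \<Rightarrow> 'e rel" where
  "fr X = (Id_on (Rd X) O sloc X O Id_on (Wr X)) - ((rf X)\<inverse> O ((co X)\<inverse>)\<^sup>*)"

definition com :: "('e, 'x) exec_scheme \<Rightarrow> 'e rel" where
  "com X = rf X \<union> co X \<union> fr X"

definition wf_cpp_exec :: "('e, 'x) cpp_exec_scheme \<Rightarrow> bool" where
  "wf_cpp_exec X \<longleftrightarrow>
     wf_exec X \<and>
     Ato X \<subseteq> evts X \<and> Acq X \<subseteq> Ato X \<and> Rel X \<subseteq> Ato X \<and> SC X \<subseteq> Ato X \<and>
     Rd X \<inter> SC X \<subseteq> Acq X \<and> Wr X \<inter> SC X \<subseteq> Rel X \<and> Fn X \<inter> SC X \<subseteq> Acq X \<inter> Rel X \<and>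
     Field (rmw X) \<subseteq> Ato X \<and>
     sym (stxn_at X) \<and> trans (stxn_at X) \<and>
     Field (stxn_at X) // stxn_at X \<subseteq> Field (stxn X) // stxn X"

definition sw :: "('e, 'x) cpp_exec_scheme \<Rightarrow> 'e rel" where
  "sw X =
     Id_on (Rel X) O (Id_on (Fn X) O po X)\<^sup>= O Id_on (Wr X) O (same_loc X (po X))\<^sup>* O
     Id_on (Wr X \<inter> Ato X) O (rf X O rmw X)\<^sup>* O rf X O Id_on (Rd X \<inter> Ato X) O
     (po X O Id_on (Fn X))\<^sup>= O Id_on (Acq X)"

definition ecom :: "('e, 'x) exec_scheme \<Rightarrow> 'e rel" where
  "ecom X = com X \<union> (co X O rf X)"

definition tsw :: "('e, 'x) exec_scheme \<Rightarrow> 'e rel" where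
  "tsw X = weaklift (ecom X) (stxn X)"

definition hb :: "('e, 'x) cpp_exec_scheme \<Rightarrow> 'e rel" where
  "hb X = (sw X \<union> tsw X \<union> po X)\<^sup>+"

definition scb :: "('e, 'x) cpp_exec_scheme \<Rightarrow> 'e rel" where
  "scb X =
     po X \<union> (diff_loc X (po X) O hb X O diff_loc X (po X)) \<union> same_loc X (hb X) \<union> co X \<union> fr X"

definition psc :: "('e, 'x) cpp_exec_scheme \<Rightarrow> 'e rel" where
  "psc X =
     ((Id_on (SC X) \<union> (Id_on (Fn X \<inter> SC X) O (hb X)\<^sup>=)) O scb X O
      (Id_on (SC X) \<union> ((hb X)\<^sup>= O Id_on (Fn X \<inter> SC X)))) \<union>
     (Id_on (Fn X \<inter> SC X) O (hb X \<union> (hb X O (com X)\<^sup>+ O hb X)) O Id_on (Fn X \<inter> SC X))"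

definition cnf :: "('e, 'x) exec_scheme \<Rightarrow> 'e rel" where
  "cnf X = (((Wr X \<times> Wr X) \<union> (Rd X \<times> Wr X) \<union> (Wr X \<times> Rd X)) \<inter> sloc X) - Id"

definition HbCom :: "('e, 'x) cpp_exec_scheme \<Rightarrow> bool" where
  "HbCom X \<longleftrightarrow> irrefl (hb X O (com X)\<^sup>*)"

definition RMWIsol :: "('e, 'x) exec_scheme \<Rightarrow> bool" where
  "RMWIsol X \<longleftrightarrow> rmw X \<inter> (ext X (fr X) O ext X (co X)) = {}"

definition NoThinAir :: "('e, 'x) exec_scheme \<Rightarrow> bool" where
  "NoThinAir X \<longleftrightarrow> acyclic (po X \<union> rf X)"

definition SeqCst :: "('e, 'x) cpp_exec_scheme \<Rightarrow> bool" where
  "SeqCst X \<longleftrightarrow> acyclic (psc X)"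

definition NoRace :: "('e, 'x) cpp_exec_scheme \<Rightarrow> bool" where
  "NoRace X \<longleftrightarrow> cnf X - Ato X \<times> Ato X - (hb X \<union> (hb X)\<inverse>) = {}"

end

theory Submission
  imports Defs
begin

text \<open>
  Write \<open>t\<close> for \<^term>\<open>stxn_at X\<close>. A chain of communication edges between two events outside
  \<^term>\<open>Ato X\<close> lies in happens-before: its end points conflict (or it splits as \<open>fr; rf\<close> into two
  conflicts), races are excluded, and HbCom fixes the direction. As \<open>sw\<close> neither starts nor ends
  in an atomic transaction, a happens-before path can only leave or enter one through \<open>po\<close> or \<open>tsw\<close>,
  and both of these relate the whole transaction to the outside event. Hence \<open>t; (com - t)\<^sup>+; t\<close> is
  contained in \<open>hb\<close>, so a cycle of the strong lifting that meets a transaction yields a cycle in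
  \<open>hb\<close>, while a cycle that meets none is a cycle in \<open>com\<close>.
\<close>

section \<open>Acyclicity of a strong lifting over an arbitrary partial equivalence\<close>

text \<open>Adjacent \<open>t\<close> steps of a cycle merge by transitivity. What remains is a
  cycle of \<open>r - t\<close>, or it can be rotated to start after a \<open>t\<close> step and
  then splits into segments \<open>t; (r - t)^+; t\<close>.\<close>

lemma acyclic_stronglift:
  assumes "sym t" and "trans t"
    and acyc: "acyclic (r - t)" and lift: "acyclic (t O (r - t)\<^sup>+ O t)"
  shows "acyclic (stronglift r t)"
proof (rule acyclicI, intro allI notI)
  define P where "P = r - t"
  \<comment> \<open>\<open>M\<close> holds the normalised paths: they begin and end with a
    \<open>P\<close> edge, and no two \<open>t\<close> steps are adjacent.\<close>
  define M where "M = P\<^sup>+ O (t O P\<^sup>+)\<^sup>*"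
  note symt = symD[OF \<open>sym t\<close>] and transt = transD[OF \<open>trans t\<close>]
  have M_lift: "(x, y') \<in> (t O P\<^sup>+ O t)\<^sup>+" if "(x, x') \<in> t" "(x', y) \<in> M" "(y, y') \<in> t" for x x' y y'
  proof -
    from that(2) obtain z where z: "(x', z) \<in> P\<^sup>+" "(z, y) \<in> (t O P\<^sup>+)\<^sup>*"
      by (auto simp: M_def)
    have "\<forall>y'. (y, y') \<in> t \<longrightarrow> (x, y') \<in> (t O P\<^sup>+ O t)\<^sup>+"
      using z(2)
    proof (induction rule: rtrancl_induct)
      case base
      then show ?case using that(1) z(1) by blast
    next
      case (step u v)
      then obtain w where w: "(u, w) \<in> t" "(w, v) \<in> P\<^sup>+" by blast
      \<comment> \<open>Reflexivity of \<open>t\<close> at \<open>w\<close> splits the single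
        \<open>t\<close> step between two blocks in two, so that it closes one segment and opens the
        next.\<close>
      have ww: "(w, w) \<in> t" using w(1) symt transt by blast
      show ?case
      proof (intro allI impI)
        fix y' assume "(v, y') \<in> t"
        with ww w(2) have "(w, y') \<in> t O P\<^sup>+ O t" by blast
        with step.IH w(1) show "(x, y') \<in> (t O P\<^sup>+ O t)\<^sup>+" by (meson trancl.trancl_into_trancl)
      qed
    qed
    with that(3) show ?thesis by blast
  qed
  have M_extend: "(a, c) \<in> M" if "(a, b) \<in> M" "(b, c) \<in> P\<^sup>+" for a b c
  proof -
    from that(1) obtain z where z: "(a, z) \<in> P\<^sup>+" "(z, b) \<in> (t O P\<^sup>+)\<^sup>*"
      by (auto simp: M_def)
    from z(2) show ?thesis
    proof (cases rule: rtranclE)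
      case base
      then have "(a, c) \<in> P\<^sup>+" using z(1) that(2) by (auto intro: trancl_trans)
      then show ?thesis by (auto simp: M_def)
    next
      case (step u)
      then have "(u, c) \<in> t O P\<^sup>+" using that(2) by (auto intro: trancl_trans)
      with step(1) have "(z, c) \<in> (t O P\<^sup>+)\<^sup>*" by simp
      with z(1) show ?thesis by (auto simp: M_def)
    qed
  qed
  have M_lift_extend: "(a, d) \<in> M" if "(a, b) \<in> M" "(b, c) \<in> t" "(c, d) \<in> P\<^sup>+" for a b c d
    using that unfolding M_def by (blast intro: rtrancl.rtrancl_into_rtrancl)
  have S_M: "(x, y) \<in> t\<^sup>= O M O t\<^sup>=" if "(x, y) \<in> (stronglift r t)\<^sup>+" for x y
    using that
  proof (induction rule: trancl_induct)
    case (base y)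
    have "P \<subseteq> M" by (auto simp: M_def)
    with base show ?case by (fastforce simp: stronglift_def P_def)
  next
    case (step y z)
    from step.IH obtain a b where ab: "(x, a) \<in> t\<^sup>=" "(a, b) \<in> M" "(b, y) \<in> t\<^sup>=" by blast
    from step.hyps(2) obtain c d where cd: "(y, c) \<in> t\<^sup>=" "(c, d) \<in> P" "(d, z) \<in> t\<^sup>="
      by (auto simp: stronglift_def P_def)
    \<comment> \<open>The trailing \<open>t\<close> step of one lifted edge and the leading one of
      the next merge.\<close>
    have "(b, c) \<in> t\<^sup>=" using ab(3) cd(1) transt by auto
    then have "(a, d) \<in> M" using M_extend M_lift_extend ab(2) cd(2) by blast
    with ab(1) cd(3) show ?case by blast
  qed
  have no_lift: False if "(v, y) \<in> M" "(y, v) \<in> t" for v y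
  proof -
    have "(v, v) \<in> t" using that(2) symt transt by blast
    then have "(v, v) \<in> (t O P\<^sup>+ O t)\<^sup>+" using M_lift that by blast
    with lift show False by (auto simp: acyclic_def P_def)
  qed
  fix x assume "(x, x) \<in> (stronglift r t)\<^sup>+"
  from S_M[OF this] obtain y z where yz: "(x, y) \<in> t\<^sup>=" "(y, z) \<in> M" "(z, x) \<in> t\<^sup>=" by blast
  have "(z, y) \<in> t\<^sup>=" using yz(1,3) transt by auto
  with no_lift yz(2) have yy: "(y, y) \<in> M" by auto
  then obtain u where u: "(y, u) \<in> P\<^sup>+" "(u, y) \<in> (t O P\<^sup>+)\<^sup>*" by (auto simp: M_def)
  from u(2) show False
  proof (cases rule: converse_rtranclE)
    case base
    with u(1) acyc show False by (auto simp: acyclic_def P_def)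
  next
    case (step w)
    \<comment> \<open>The cycle is rotated to start at \<open>v\<close>, just after its first
      \<open>t\<close> step, so that this step closes it.\<close>
    then obtain v where v: "(u, v) \<in> t" "(v, w) \<in> P\<^sup>+" by blast
    have "(v, y) \<in> M" using v(2) step(2) by (auto simp: M_def)
    then have "(v, u) \<in> M" using M_extend u(1) by blast
    with no_lift v(1) show False by blast
  qed
qed

section \<open>Types and order properties of communication edges\<close>

lemma rf_typed:
  assumes "wf_exec X" and "(a, b) \<in> rf X"
  shows "a \<in> Wr X" "b \<in> Rd X" "(a, b) \<in> sloc X"
  using assms unfolding wf_exec_def by blast+

lemma co_typed:
  assumes "wf_exec X" and "(a, b) \<in> co X"
  shows "a \<in> Wr X" "b \<in> Wr X" "(a, b) \<in> sloc X"
  using assms unfolding wf_exec_def by blast+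

lemma fr_typed:
  assumes "(a, b) \<in> fr X"
  shows "a \<in> Rd X" "b \<in> Wr X" "(a, b) \<in> sloc X"
  using assms unfolding fr_def by blast+

lemma Rd_Wr_disjoint: "wf_exec X \<Longrightarrow> a \<in> Rd X \<Longrightarrow> a \<notin> Wr X"
  unfolding wf_exec_def by blast

lemma equiv_sloc: "wf_exec X \<Longrightarrow> equiv (Rd X \<union> Wr X) (sloc X)"
  unfolding wf_exec_def by blast

lemma sloc_sym: "wf_exec X \<Longrightarrow> (a, b) \<in> sloc X \<Longrightarrow> (b, a) \<in> sloc X"
  by (meson equiv_sloc equivE symD)

lemma sloc_trans: "wf_exec X \<Longrightarrow> (a, b) \<in> sloc X \<Longrightarrow> (b, c) \<in> sloc X \<Longrightarrow> (a, c) \<in> sloc X"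
  by (meson equiv_sloc equivE transD)

lemma co_linear:
  assumes "wf_exec X" and "a \<in> Wr X"
  defines "L \<equiv> sloc X `` {a} \<inter> Wr X"
  shows "strict_linear_order_on L (Restr (co X) L)"
  using assms unfolding wf_exec_def L_def by (blast intro: quotientI)

lemma self_sloc: "wf_exec X \<Longrightarrow> a \<in> Wr X \<Longrightarrow> (a, a) \<in> sloc X"
  by (metis UnI2 equiv_sloc eq_equiv_class_iff)

lemma co_irrefl:
  assumes "wf_exec X"
  shows "(a, a) \<notin> co X"
  using co_linear[OF assms, of a] co_typed[OF assms, of a a]
  unfolding strict_linear_order_on_def irrefl_def by blast

lemma co_trans:
  assumes wf: "wf_exec X" and ab: "(a, b) \<in> co X" and bc: "(b, c) \<in> co X"
  shows "(a, c) \<in> co X"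
proof -
  note W = co_typed[OF wf ab] co_typed[OF wf bc]
  have "(a, a) \<in> sloc X" "(a, c) \<in> sloc X"
    using self_sloc[OF wf] sloc_trans[OF wf] W by blast+
  moreover have "trans (Restr (co X) (sloc X `` {a} \<inter> Wr X))"
    using co_linear[OF wf W(1)] by (simp add: strict_linear_order_on_def)
  ultimately show ?thesis
    using W ab bc by (auto dest!: transD[of _ a b c])
qed

lemma co_total:
  assumes wf: "wf_exec X" and "a \<in> Wr X" "b \<in> Wr X" "(a, b) \<in> sloc X" "a \<noteq> b"
  shows "(a, b) \<in> co X \<or> (b, a) \<in> co X"
  using co_linear[OF wf assms(2)] self_sloc[OF wf assms(2)] assms
  unfolding strict_linear_order_on_def total_on_def by blast

section \<open>Composition of communication edges\<close>

text \<open>If \<open>w'\<close> were \<open>w\<close> or \<open>co\<close>-before it, then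
  \<open>(r, w')\<close> would lie in the set that \<open>fr\<close> subtracts; totality of
  \<open>co\<close> leaves only the claimed order.\<close>

lemma rf_fr_subset_co:
  assumes wf: "wf_exec X" and "(w, r) \<in> rf X" "(r, w') \<in> fr X"
  shows "(w, w') \<in> co X"
proof -
  note typed = rf_typed[OF wf assms(2)] fr_typed[OF assms(3)]
  have no: "(w, w') \<notin> ((co X)\<inverse>)\<^sup>*" using assms(2,3) unfolding fr_def by blast
  then have "w \<noteq> w'" "(w', w) \<notin> co X" by auto
  with co_total[OF wf typed(1,5)] sloc_trans[OF wf typed(3,6)] show ?thesis by blast
qed

text \<open>If backward \<open>co\<close> steps led from the source of \<open>r\<close> to
  \<open>w'\<close>, one more would reach \<open>w\<close>, contradicting
  \<open>(r, w) \<in> fr X\<close>. Reads of the initial value need no separate case.\<close>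

lemma fr_co_subset_fr:
  assumes wf: "wf_exec X" and rw: "(r, w) \<in> fr X" and ww: "(w, w') \<in> co X"
  shows "(r, w') \<in> fr X"
proof -
  have "(w', w) \<in> (co X)\<inverse>" using ww by simp
  then have "(r, w') \<notin> (rf X)\<inverse> O ((co X)\<inverse>)\<^sup>*"
    using rw unfolding fr_def by (blast intro: rtrancl.rtrancl_into_rtrancl)
  moreover have "(r, w') \<in> sloc X"
    using sloc_trans[OF wf] fr_typed[OF rw] co_typed[OF wf ww] by blast
  ultimately show ?thesis
    using fr_typed[OF rw] co_typed[OF wf ww] unfolding fr_def by blast
qed

text \<open>The pairs \<open>rf; fr\<close>, \<open>co; co\<close> and \<open>fr; co\<close>
  collapse to one \<open>co\<close> or \<open>fr\<close> edge, and all other pairs not ending in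
  \<open>rf\<close> are ill-typed, as is \<open>rf; rf\<close>. Hence only a final \<open>rf\<close>
  can survive uncollapsed.\<close>

lemma trancl_com_subset:
  assumes wf: "wf_exec X"
  shows "(com X)\<^sup>+ \<subseteq> ecom X \<union> fr X O rf X"
proof (rule subrelI)
  fix a b assume "(a, b) \<in> (com X)\<^sup>+"
  then show "(a, b) \<in> ecom X \<union> fr X O rf X"
  proof (induction rule: trancl_induct)
    case (base b)
    then show ?case by (simp add: ecom_def)
  next
    case (step b c)
    note typed = rf_typed[OF wf] co_typed[OF wf] fr_typed Rd_Wr_disjoint[OF wf]
    note compose = rf_fr_subset_co[OF wf] fr_co_subset_fr[OF wf] co_trans[OF wf]
    consider "(b, c) \<in> rf X" | "(b, c) \<in> co X" | "(b, c) \<in> fr X"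
      using step.hyps(2) by (auto simp: com_def)
    then show ?case
    proof cases
      case 1
      then have "b \<in> Wr X" by (blast dest: typed)
      then have "(a, b) \<in> co X \<union> fr X"
        using step.IH unfolding ecom_def com_def by (blast dest: typed)
      with 1 show ?thesis unfolding ecom_def by blast
    next
      case 2
      then have "b \<in> Wr X" by (blast dest: typed)
      then have "(a, b) \<in> co X \<union> fr X"
        using step.IH unfolding ecom_def com_def by (blast dest: typed)
      with 2 have "(a, c) \<in> co X \<union> fr X" by (blast intro: compose)
      then show ?thesis unfolding ecom_def com_def by blast
    next
      case 3
      then have "b \<in> Rd X" by (blast dest: typed)
      then have "(a, b) \<in> rf X \<union> co X O rf X \<union> fr X O rf X"
        using step.IH unfolding ecom_def com_def by (blast dest: typed)
      with 3 have "(a, c) \<in> co X \<union> fr X" by (blast intro: compose)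
      then show ?thesis unfolding ecom_def com_def by blast
    qed
  qed
qed

lemma ecom_subset_cnf:
  assumes wf: "wf_exec X"
  shows "ecom X \<subseteq> cnf X"
proof (rule subrelI)
  fix a b assume ab: "(a, b) \<in> ecom X"
  note typed = rf_typed[OF wf] co_typed[OF wf] fr_typed Rd_Wr_disjoint[OF wf]
  consider "(a, b) \<in> rf X" | "(a, b) \<in> co X" | "(a, b) \<in> fr X"
    | w where "(a, w) \<in> co X" "(w, b) \<in> rf X"
    using ab by (auto simp: ecom_def com_def)
  then show "(a, b) \<in> cnf X"
  proof cases
    case 1
    then have "a \<in> Wr X" "b \<in> Rd X" "(a, b) \<in> sloc X" "a \<noteq> b" by (blast dest: typed)+
    then show ?thesis by (simp add: cnf_def)
  next
    case 2
    then have "a \<in> Wr X" "b \<in> Wr X" "(a, b) \<in> sloc X" "a \<noteq> b"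
      by (blast dest: typed co_irrefl[OF wf, THEN notE])+
    then show ?thesis by (simp add: cnf_def)
  next
    case 3
    then have "a \<in> Rd X" "b \<in> Wr X" "(a, b) \<in> sloc X" "a \<noteq> b" by (blast dest: typed)+
    then show ?thesis by (simp add: cnf_def)
  next
    case 4
    then have "a \<in> Wr X" "b \<in> Rd X" "(a, b) \<in> sloc X" "a \<noteq> b"
      by (blast dest: typed intro: sloc_trans[OF wf])+
    then show ?thesis by (simp add: cnf_def)
  qed
qed

text \<open>Conflicts are irreflexive, which rules out an \<open>ecom\<close> loop. A loop
  \<open>fr; rf\<close> would make a read precede in \<open>fr\<close> the very write it reads
  from.\<close>

lemma acyclic_com:
  assumes wf: "wf_exec X"
  shows "acyclic (com X)"
proof (rule acyclicI, intro allI notI)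
  fix a assume "(a, a) \<in> (com X)\<^sup>+"
  moreover have "(a, a) \<notin> ecom X" using ecom_subset_cnf[OF wf] by (auto simp: cnf_def)
  ultimately have "(a, a) \<in> fr X O rf X" using trancl_com_subset[OF wf] by blast
  then show False unfolding fr_def by blast
qed

section \<open>From race freedom to happens-before\<close>

text \<open>NoRace orders the conflict in one direction, and a backward \<open>hb\<close> edge would
  close a loop forbidden by HbCom. One non-atomic end suffices, because NoRace exempts only pairs
  with both ends atomic.\<close>

lemma ecom_in_hb:
  assumes "wf_exec X" "HbCom X" "NoRace X"
    and ab: "(a, b) \<in> ecom X" and non_atomic: "a \<notin> Ato X \<or> b \<notin> Ato X"
  shows "(a, b) \<in> hb X"
proof (rule ccontr)
  assume "(a, b) \<notin> hb X"
  moreover have "(a, b) \<in> cnf X" using ecom_subset_cnf assms(1) ab by blast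
  ultimately have "(b, a) \<in> hb X"
    using \<open>NoRace X\<close> non_atomic unfolding NoRace_def by blast
  moreover have "(a, b) \<in> (com X)\<^sup>*"
    using ab unfolding ecom_def com_def by (blast intro: rtrancl_trans)
  ultimately show False using \<open>HbCom X\<close> unfolding HbCom_def irrefl_def by blast
qed

text \<open>The shape \<open>fr; rf\<close> relates two reads and is no conflict itself. Its middle
  write may be atomic, but each half has a non-atomic end.\<close>

lemma trancl_com_in_hb:
  assumes "wf_exec X" "HbCom X" "NoRace X"
    and ab: "(a, b) \<in> (com X)\<^sup>+" and non_atomic: "a \<notin> Ato X" "b \<notin> Ato X"
  shows "(a, b) \<in> hb X"
proof -
  note in_hb = ecom_in_hb[OF assms(1-3)]
  consider "(a, b) \<in> ecom X" | w where "(a, w) \<in> fr X" "(w, b) \<in> rf X"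
    using trancl_com_subset[OF assms(1)] ab by blast
  then show ?thesis
  proof cases
    case 1
    then show ?thesis using in_hb non_atomic by blast
  next
    case 2
    then have "(a, w) \<in> hb X" "(w, b) \<in> hb X"
      using in_hb non_atomic by (auto simp: ecom_def com_def)
    then show ?thesis unfolding hb_def by (rule trancl_trans)
  qed
qed

section \<open>Transactions as classes and their boundaries\<close>

text \<open>Release and acquire events are atomic operations. This keeps \<open>sw\<close> edges
  from starting or ending in atomic transactions.\<close>

lemma sw_endpoints:
  assumes "wf_cpp_exec X" and "(a, b) \<in> sw X"
  shows "a \<in> Ato X" "b \<in> Ato X"
  using assms unfolding wf_cpp_exec_def sw_def by blast+

lemma stxn_at_sym: "wf_cpp_exec X \<Longrightarrow> (a, b) \<in> stxn_at X \<Longrightarrow> (b, a) \<in> stxn_at X"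
  unfolding wf_cpp_exec_def by (blast dest: symD)

lemma stxn_at_trans:
  "wf_cpp_exec X \<Longrightarrow> (a, b) \<in> stxn_at X \<Longrightarrow> (b, c) \<in> stxn_at X \<Longrightarrow> (a, c) \<in> stxn_at X"
  unfolding wf_cpp_exec_def by (blast dest: transD)

lemma stxn_sym: "wf_exec X \<Longrightarrow> (a, b) \<in> stxn X \<Longrightarrow> (b, a) \<in> stxn X"
  unfolding wf_exec_def by (blast dest: symD)

lemma stxn_trans: "wf_exec X \<Longrightarrow> (a, b) \<in> stxn X \<Longrightarrow> (b, c) \<in> stxn X \<Longrightarrow> (a, c) \<in> stxn X"
  unfolding wf_exec_def by (blast dest: transD)

lemma stxn_at_class:
  assumes "wf_cpp_exec X" and "(a, b) \<in> stxn_at X"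
  shows "stxn_at X `` {a} \<in> Field (stxn X) // stxn X"
proof -
  have "stxn_at X `` {a} \<in> Field (stxn_at X) // stxn_at X"
    using assms(2) by (auto simp: Field_def intro: quotientI)
  then show ?thesis using assms(1) unfolding wf_cpp_exec_def by blast
qed

text \<open>Well-formedness speaks only of classes: the \<open>stxn_at\<close> class of
  \<open>a\<close> is the \<open>stxn\<close> class of some \<open>c\<close>, and it contains both
  \<open>a\<close> and \<open>b\<close>.\<close>

lemma stxn_at_subset_stxn:
  assumes wf: "wf_cpp_exec X"
  shows "stxn_at X \<subseteq> stxn X"
proof (rule subrelI)
  fix a b assume ab: "(a, b) \<in> stxn_at X"
  then have aa: "(a, a) \<in> stxn_at X" using stxn_at_sym[OF wf] stxn_at_trans[OF wf] by blast
  from stxn_at_class[OF wf ab] obtain c where "stxn_at X `` {a} = stxn X `` {c}"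
    by (auto elim: quotientE)
  with ab aa have "(c, a) \<in> stxn X" "(c, b) \<in> stxn X" by blast+
  moreover have "wf_exec X" using wf by (simp add: wf_cpp_exec_def)
  ultimately show "(a, b) \<in> stxn X" by (metis stxn_sym stxn_trans)
qed

lemma stxn_at_contiguous:
  assumes wf: "wf_cpp_exec X" and ab: "(a, b) \<in> stxn_at X"
  shows "po_contiguous X (stxn_at X `` {a})"
proof -
  have "wf_exec X" using wf by (simp add: wf_cpp_exec_def)
  then show ?thesis using stxn_at_class[OF assms] unfolding wf_exec_def by blast
qed

lemma po_total:
  assumes wf: "wf_exec X" and "T \<in> threads X" "a \<in> T" "b \<in> T" "a \<noteq> b"
  shows "(a, b) \<in> po X \<or> (b, a) \<in> po X"
proof -
  have "total_on T (Restr (po X) T)"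
    using assms(1,2) unfolding wf_exec_def strict_linear_order_on_def by blast
  with assms(3-5) show ?thesis unfolding total_on_def by blast
qed

lemma po_same_thread:
  assumes wf: "wf_exec X" and "(a, b) \<in> po X" "T \<in> threads X"
  shows "a \<in> T \<longleftrightarrow> b \<in> T"
proof -
  obtain T' where T': "T' \<in> threads X" "a \<in> T'" "b \<in> T'"
    using assms(1,2) unfolding wf_exec_def by blast
  have "disjoint (threads X)" using wf unfolding wf_exec_def partition_on_def by blast
  then show ?thesis using T' assms(3) unfolding disjoint_def by blast
qed

text \<open>All three events share a thread. Were \<open>z\<close> before \<open>a'\<close>, it
  would lie between two events of the class and belong to it by contiguity; totality of
  \<open>po\<close> gives the other order.\<close>

lemma po_leaves_stxn_at:
  assumes wf: "wf_cpp_exec X" and aa: "(a', a) \<in> stxn_at X"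
    and az: "(a, z) \<in> po X" "(a, z) \<notin> stxn_at X"
  shows "(a', z) \<in> po X"
proof -
  have wf': "wf_exec X" using wf by (simp add: wf_cpp_exec_def)
  let ?C = "stxn_at X `` {a}"
  have C: "a \<in> ?C" "a' \<in> ?C" "z \<notin> ?C"
    using aa az(2) stxn_at_sym[OF wf] stxn_at_trans[OF wf] by blast+
  from C(1) have contig: "po_contiguous X ?C" using stxn_at_contiguous[OF wf] by blast
  then obtain T where T: "T \<in> threads X" "?C \<subseteq> T" unfolding po_contiguous_def by blast
  with C have "a \<in> T" "a' \<in> T" by blast+
  moreover from this have "z \<in> T" using po_same_thread[OF wf' az(1) T(1)] by blast
  moreover have "(z, a') \<notin> po X" using contig C az(1) unfolding po_contiguous_def by blast
  ultimately show ?thesis using po_total[OF wf' T(1)] C by blast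
qed

lemma po_enters_stxn_at:
  assumes wf: "wf_cpp_exec X" and bb: "(b, b') \<in> stxn_at X"
    and zb: "(z, b) \<in> po X" "(z, b) \<notin> stxn_at X"
  shows "(z, b') \<in> po X"
proof -
  have wf': "wf_exec X" using wf by (simp add: wf_cpp_exec_def)
  let ?C = "stxn_at X `` {b}"
  have C: "b \<in> ?C" "b' \<in> ?C" "z \<notin> ?C"
    using bb zb(2) stxn_at_sym[OF wf] stxn_at_trans[OF wf] by blast+
  from C(1) have contig: "po_contiguous X ?C" using stxn_at_contiguous[OF wf] by blast
  then obtain T where T: "T \<in> threads X" "?C \<subseteq> T" unfolding po_contiguous_def by blast
  with C have "b \<in> T" "b' \<in> T" by blast+
  moreover from this have "z \<in> T" using po_same_thread[OF wf' zb(1) T(1)] by blast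
  moreover have "(b', z) \<notin> po X" using contig C zb(1) unfolding po_contiguous_def by blast
  ultimately show ?thesis using po_total[OF wf' T(1)] C by blast
qed

lemma stxn_tsw:
  assumes "wf_exec X" "(a', a) \<in> stxn X" "(a, z) \<in> tsw X"
  shows "(a', z) \<in> tsw X"
  using assms(2,3) stxn_trans[OF assms(1)] unfolding tsw_def weaklift_def by blast

lemma tsw_stxn:
  assumes "wf_exec X" "(z, b) \<in> tsw X" "(b, b') \<in> stxn X"
  shows "(z, b') \<in> tsw X"
  using assms(2,3) stxn_trans[OF assms(1)] unfolding tsw_def weaklift_def by blast

section \<open>Moving the ends of happens-before paths within a transaction\<close>

text \<open>The path is followed to its first step out of the transaction. That step is
  \<open>po\<close> or \<open>tsw\<close>, so it can equally be taken from
  \<open>a'\<close>.\<close>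

lemma hb_leaves_stxn_at:
  assumes wf: "wf_cpp_exec X" and non_atomic: "Domain (stxn_at X) \<inter> Ato X = {}"
    and ay: "(a, y) \<in> hb X" and "(a', a) \<in> stxn_at X" "(a, y) \<notin> stxn_at X"
  shows "(a', y) \<in> hb X"
proof -
  let ?s = "sw X \<union> tsw X \<union> po X"
  have wf': "wf_exec X" using wf by (simp add: wf_cpp_exec_def)
  have leave: "(a', z) \<in> ?s"
    if "(a, z) \<in> ?s" "(a', a) \<in> stxn_at X" "(a, z) \<notin> stxn_at X" for a z
  proof -
    have "a \<notin> Ato X" using that(2) stxn_at_sym[OF wf] non_atomic by blast
    then have "(a, z) \<in> tsw X \<union> po X" using that(1) sw_endpoints[OF wf] by blast
    then show ?thesis
      using stxn_tsw[OF wf'] stxn_at_subset_stxn[OF wf] po_leaves_stxn_at[OF wf] that(2,3) by blast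
  qed
  have "(a, y) \<in> ?s\<^sup>+" using ay by (simp add: hb_def)
  then have "(a', a) \<in> stxn_at X \<longrightarrow> (a, y) \<notin> stxn_at X \<longrightarrow> (a', y) \<in> ?s\<^sup>+"
  proof (induction rule: converse_trancl_induct)
    case (base a)
    then show ?case using leave by blast
  next
    case (step a z)
    show ?case
    proof (intro impI)
      assume a: "(a', a) \<in> stxn_at X" "(a, y) \<notin> stxn_at X"
      show "(a', y) \<in> ?s\<^sup>+"
      \<comment> \<open>If the step stays inside, \<open>z\<close> replaces \<open>a\<close> in the
        induction hypothesis; otherwise the step itself moves to \<open>a'\<close>.\<close>
      proof (cases "(a, z) \<in> stxn_at X")
        case True
        with a step.IH stxn_at_trans[OF wf] show ?thesis by blast
      next
        case False
        with a step.hyps(1) have "(a', z) \<in> ?s" by (intro leave)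
        then show ?thesis using step.hyps(2) by (rule trancl_into_trancl2)
      qed
    qed
  qed
  with assms(4,5) show ?thesis by (simp add: hb_def)
qed

text \<open>The dual argument: induction from the end of the path finds the last step into the
  transaction and redirects it to \<open>b'\<close>.\<close>

lemma hb_enters_stxn_at:
  assumes wf: "wf_cpp_exec X" and non_atomic: "Domain (stxn_at X) \<inter> Ato X = {}"
    and xb: "(x, b) \<in> hb X" and "(b, b') \<in> stxn_at X" "(x, b) \<notin> stxn_at X"
  shows "(x, b') \<in> hb X"
proof -
  let ?s = "sw X \<union> tsw X \<union> po X"
  have wf': "wf_exec X" using wf by (simp add: wf_cpp_exec_def)
  have enter: "(z, b') \<in> ?s"
    if "(z, b) \<in> ?s" "(b, b') \<in> stxn_at X" "(z, b) \<notin> stxn_at X" for b z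
  proof -
    have "b \<notin> Ato X" using that(2) non_atomic by blast
    then have "(z, b) \<in> tsw X \<union> po X" using that(1) sw_endpoints[OF wf] by blast
    then show ?thesis
      using tsw_stxn[OF wf'] stxn_at_subset_stxn[OF wf] po_enters_stxn_at[OF wf] that(2,3) by blast
  qed
  have "(x, b) \<in> ?s\<^sup>+" using xb by (simp add: hb_def)
  then have "(b, b') \<in> stxn_at X \<longrightarrow> (x, b) \<notin> stxn_at X \<longrightarrow> (x, b') \<in> ?s\<^sup>+"
  proof (induction rule: trancl_induct)
    case (base b)
    then show ?case using enter by blast
  next
    case (step z b)
    show ?case
    proof (intro impI)
      assume b: "(b, b') \<in> stxn_at X" "(x, b) \<notin> stxn_at X"
      show "(x, b') \<in> ?s\<^sup>+"
      proof (cases "(z, b) \<in> stxn_at X")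
        case True
        with b step.IH stxn_at_trans[OF wf] show ?thesis by blast
      next
        case False
        with b step.hyps(2) have "(z, b') \<in> ?s" by (intro enter)
        with step.hyps(1) show ?thesis by (rule trancl.trancl_into_trancl)
      qed
    qed
  qed
  with assms(4,5) show ?thesis by (simp add: hb_def)
qed

theorem theorem7p2:
  fixes X :: "'e cpp_exec"
  assumes "wf_cpp_exec X"
    and "HbCom X" and "RMWIsol X" and "NoThinAir X" and "SeqCst X"
    and "NoRace X"
    and "Domain (stxn_at X) \<inter> Ato X = {}"
  shows "acyclic (stronglift (com X) (stxn_at X))"
proof (rule acyclic_stronglift)
  let ?t = "stxn_at X"
  note wf = assms(1) and non_atomic = assms(7)
  have wf': "wf_exec X" using wf by (simp add: wf_cpp_exec_def)
  have HbCom: False if "(a, b) \<in> hb X" "(b, a) \<in> (com X)\<^sup>*" for a b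
    using \<open>HbCom X\<close> that unfolding HbCom_def irrefl_def by blast
  note leave = hb_leaves_stxn_at[OF wf non_atomic] and enter = hb_enters_stxn_at[OF wf non_atomic]
  note t_sym = stxn_at_sym[OF wf] and t_trans = stxn_at_trans[OF wf]
  show "sym ?t" "trans ?t" using wf unfolding wf_cpp_exec_def by blast+
  show "acyclic (com X - ?t)" by (rule acyclic_subset[OF acyclic_com[OF wf']]) blast
  have "?t O (com X - ?t)\<^sup>+ O ?t \<subseteq> hb X"
  proof (rule subrelI)
    fix a' b' assume "(a', b') \<in> ?t O (com X - ?t)\<^sup>+ O ?t"
    then obtain a b where a: "(a', a) \<in> ?t" and ab: "(a, b) \<in> (com X - ?t)\<^sup>+" and b: "(b, b') \<in> ?t"
      by blast
    have not_atomic: "a \<notin> Ato X" "b \<notin> Ato X" using a b t_sym non_atomic by blast+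
    \<comment> \<open>\<open>leave\<close> needs a path that ends outside the transaction. If
      \<open>a\<close> and \<open>b\<close> shared one, the first edge \<open>a\<close> to
      \<open>w\<close> would leave it and lie in \<open>hb\<close>; moved to start at
      \<open>b\<close>, it would form a forbidden loop with the rest of the chain from
      \<open>w\<close> back to \<open>b\<close>.\<close>
    have "(a, b) \<notin> ?t"
    proof
      assume t: "(a, b) \<in> ?t"
      from ab obtain w where w: "(a, w) \<in> com X - ?t" "(w, b) \<in> (com X - ?t)\<^sup>*"
        by (meson tranclD)
      have "(a, w) \<in> hb X"
        using ecom_in_hb[OF wf' \<open>HbCom X\<close> \<open>NoRace X\<close>] w(1) not_atomic(1) by (auto simp: ecom_def)
      then have "(b, w) \<in> hb X" using leave t_sym[OF t] w(1) by blast
      moreover have "(w, b) \<in> (com X)\<^sup>*" using w(2) rtrancl_mono[of "com X - ?t" "com X"] by blast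
      ultimately show False by (rule HbCom)
    qed
    moreover have "(a, b) \<in> (com X)\<^sup>+" using ab trancl_mono[of _ "com X - ?t" "com X"] by blast
    then have "(a, b) \<in> hb X"
      using trancl_com_in_hb[OF wf' \<open>HbCom X\<close> \<open>NoRace X\<close>] not_atomic by blast
    ultimately have "(a', b) \<in> hb X" "(a', b) \<notin> ?t"
      using leave a t_sym t_trans by blast+
    then show "(a', b') \<in> hb X" using enter b by blast
  qed
  \<comment> \<open>\<open>hb\<close> is its own transitive closure, so this is HbCom with zero
    \<open>com\<close> steps.\<close>
  moreover have "acyclic (hb X)"
    using HbCom unfolding acyclic_def hb_def by auto
  ultimately show "acyclic (?t O (com X - ?t)\<^sup>+ O ?t)" by (meson acyclic_subset)
qed

end
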